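(* Let $X_1,X_2,\dots,X_n$ be Boolean independent identically distributed copies of a random variable $X$ with mean $0$ and variance $1$. Then the sums $P=\sum_{i=1}^n(X_i+a_i)^2$ have a law that depends on $(a_1,\dots,a_n)$ only through $\sum_{i=1}^na_i^2$, for every $a_i\in\mathbb R$, if and only if $X$ is a Boolean Gaussian random variable.
   Context: A noncommutative probability space is a pair $(\mathcal A,\varphi)$ with $\mathcal A$ a unital $*$-algebra and $\varphi$ a normal state; random variables are self-adjoint elements. In $X_i+a_i$ the scalar $a_i$ stands for $a_i1_{\mathcal A}$. Subalgebras $(\mathcal A_i)$ are Boolean independent if $\varphi(X_1\cdots X_m)=\varphi(X_1)\cdots\varphi(X_m)$ whenever $X_j\in\mathcal A_{i(j)}$ with consecutive indices $i(j)\neq i(j+1)$; random variables are Boolean independent if the (not necessarily unital) subalgebras they generate are (in particular the unit is not Boolean independent from the $X_i$). $\mathcal I(n)$ is the set of interval partitions of $\{1,\dots,n\}$ (blocks consist of consecutive integers). Boolean cumulants $K_n$ are the multilinear functionals defined by $\varphi(X_1\cdots X_n)=\sum_{\pi\in\mathcal I(n)}\prod_{B\in\pi}K_{|B|}(X_i:i\in B)$; $K_n(X)=K_n(X,\dots,X)$. Mean is $K_1(X)=\varphi(X)$, variance is $K_2(X)$. Identically distributed means all cumulants coincide. $X$ is Boolean Gaussian (Boolean normal) if $K_r(X)=0$ for all $r>2$.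
   Formalization: The number n of copies is taken to be at least 2; for n = 1 the equivalence fails, e.g. for X equal to −√2, 0, √2 with probabilities 1/4, 1/2, 1/4, where the law of (X+a)² depends only on a² but K_4(X) = 1. *)

theory Defs
  imports Complex_Main "HOL-Library.Disjoint_Sets" "HOL-Library.Nonpos_Ints"
begin

text \<open>
  The type \<open>'a\<close> carries the ring structure; the complex scalar multiplication and the
  involution are parameters, since the library has no class of complex algebras.
\<close>

locale complex_star_algebra = vector_space scale
  for scale :: "complex \<Rightarrow> 'a::ring_1 \<Rightarrow> 'a" +
  fixes star :: "'a \<Rightarrow> 'a"
  assumes scale_mult_left: "scale c x * y = scale c (x * y)"
    and scale_mult_right: "x * scale c y = scale c (x * y)"
    and star_star: "star (star x) = x"
    and star_add: "star (x + y) = star x + star y"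
    and star_scale: "star (scale c x) = scale (cnj c) (star x)"
    and star_mult: "star (x * y) = star y * star x"

text \<open>
  No topology or order completeness is available on a bare \<open>*\<close>-algebra, so a state is a
  positive normalised linear functional and no further continuity is imposed on it.
\<close>

locale nc_probability_space = complex_star_algebra scale star
  for scale :: "complex \<Rightarrow> 'a::ring_1 \<Rightarrow> 'a" and star :: "'a \<Rightarrow> 'a" +
  fixes \<phi> :: "'a \<Rightarrow> complex"
  assumes state_linear: "Vector_Spaces.linear scale (*) \<phi>"
    and state_positive: "\<phi> (star x * x) \<in> \<real>\<^sub>\<ge>\<^sub>0"
    and state_one: "\<phi> 1 = 1"


section \<open>Boolean independence\<close>

text \<open>Subalgebras are not required to contain the unit.\<close>

definition subalgebra :: "(complex \<Rightarrow> 'a::ring_1 \<Rightarrow> 'a) \<Rightarrow> 'a set \<Rightarrow> bool" where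
  "subalgebra scale B \<longleftrightarrow> 0 \<in> B \<and> (\<forall>x\<in>B. \<forall>y\<in>B. x + y \<in> B \<and> x * y \<in> B)
     \<and> (\<forall>c. \<forall>x\<in>B. scale c x \<in> B)"

text \<open>
  The generators considered below are self-adjoint, so the subalgebra generated by one of
  them is automatically closed under the involution.
\<close>

definition generated_subalgebra :: "(complex \<Rightarrow> 'a::ring_1 \<Rightarrow> 'a) \<Rightarrow> 'a set \<Rightarrow> 'a set" where
  "generated_subalgebra scale S = subalgebra scale hull S"

definition boolean_independent_algebras ::
    "('a::ring_1 \<Rightarrow> complex) \<Rightarrow> 'i set \<Rightarrow> ('i \<Rightarrow> 'a set) \<Rightarrow> bool" where
  "boolean_independent_algebras \<phi> I B \<longleftrightarrow>
     (\<forall>(m::nat) (i::nat \<Rightarrow> 'i) (x::nat \<Rightarrow> 'a).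
        (\<forall>j\<in>{1..m}. i j \<in> I \<and> x j \<in> B (i j)) \<longrightarrow>
        (\<forall>j\<in>{1..<m}. i j \<noteq> i (Suc j)) \<longrightarrow>
        \<phi> (prod_list (map x [1..<Suc m])) = (\<Prod>j=1..m. \<phi> (x j)))"

definition boolean_independent ::
    "(complex \<Rightarrow> 'a::ring_1 \<Rightarrow> 'a) \<Rightarrow> ('a \<Rightarrow> complex) \<Rightarrow> 'i set \<Rightarrow> ('i \<Rightarrow> 'a) \<Rightarrow> bool" where
  "boolean_independent scale \<phi> I X \<longleftrightarrow>
     boolean_independent_algebras \<phi> I (\<lambda>i. generated_subalgebra scale {X i})"


section \<open>Boolean cumulants\<close>

text \<open>
  Positions are numbered \<open>0, \<dots>, n - 1\<close> instead of \<open>1, \<dots>, n\<close>, to match \<^const>\<open>nths\<close>.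
\<close>

definition interval_partitions :: "nat \<Rightarrow> nat set set set" where
  "interval_partitions n =
     {\<pi>. partition_on {..<n} \<pi> \<and> (\<forall>B\<in>\<pi>. \<exists>a b. B = {a..<b})}"

lemma finite_interval_partitions: "finite (interval_partitions n)"
proof (rule finite_subset)
  show "interval_partitions n \<subseteq> Pow (Pow {..<n})"
    by (auto simp: interval_partitions_def partition_on_def)
qed simp

lemma full_interval_partition: "n > 0 \<Longrightarrow> {{..<n}} \<in> interval_partitions n"
  by (auto simp: interval_partitions_def partition_on_def disjoint_def lessThan_atLeast0)

lemma length_nths_less:
  assumes "\<pi> \<in> interval_partitions (length xs) - {{{..<length xs}}}" and "B \<in> \<pi>"
  shows "length (nths xs B) < length xs"
proof -
  let ?n = "length xs"
  have p: "partition_on {..<?n} \<pi>" "\<pi> \<noteq> {{..<?n}}"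
    using assms(1) by (auto simp: interval_partitions_def)
  have sub: "B \<subseteq> {..<?n}"
    using p(1) assms(2) by (auto simp: partition_on_def)
  have "B \<noteq> {..<?n}"
  proof
    assume B: "B = {..<?n}"
    have "C = B" if "C \<in> \<pi>" for C
    proof (rule ccontr)
      assume "C \<noteq> B"
      then have "C \<inter> B = {}"
        using p(1) that assms(2) by (auto simp: partition_on_def disjoint_def)
      moreover have "C \<subseteq> B" "C \<noteq> {}"
        using p(1) that B by (auto simp: partition_on_def)
      ultimately show False by blast
    qed
    then have "\<pi> = {B}"
      using assms(2) by blast
    then show False
      using p(2) B by simp
  qed
  with sub have "{i. i < ?n \<and> i \<in> B} \<subset> {..<?n}"
    by auto
  then have "card {i. i < ?n \<and> i \<in> B} < card {..<?n}"
    by (intro psubset_card_mono) auto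
  then show ?thesis
    by (simp add: length_nths)
qed

text \<open>
  \<open>boolean_cumulant \<phi> [X\<^sub>1, \<dots>, X\<^sub>n]\<close> is \<open>K\<^sub>n(X\<^sub>1, \<dots>, X\<^sub>n)\<close>.  The equation is the
  moment-cumulant formula solved for the term of the one-block partition; the formula itself
  is the lemma \<open>moment_cumulant\<close> below, and \<open>boolean_cumulant_unique\<close> says that it
  determines the cumulants.
\<close>

function boolean_cumulant :: "('a::ring_1 \<Rightarrow> complex) \<Rightarrow> 'a list \<Rightarrow> complex" where
  "boolean_cumulant \<phi> xs = \<phi> (prod_list xs) -
     (\<Sum>\<pi>\<in>interval_partitions (length xs) - {{{..<length xs}}}.
        \<Prod>B\<in>\<pi>. boolean_cumulant \<phi> (nths xs B))"
  by auto
termination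
  by (relation "measure (\<lambda>(\<phi>, xs). length xs)")
     (simp_all add: length_nths_less del: Diff_iff)

declare boolean_cumulant.simps [simp del]

lemma moment_cumulant:
  assumes "xs \<noteq> []"
  shows "\<phi> (prod_list xs) =
    (\<Sum>\<pi>\<in>interval_partitions (length xs). \<Prod>B\<in>\<pi>. boolean_cumulant \<phi> (nths xs B))"
proof -
  have "nths xs {..<length xs} = xs"
    by (simp add: nths_all)
  then show ?thesis
    using assms
    by (subst sum.remove[OF finite_interval_partitions full_interval_partition])
       (auto simp: boolean_cumulant.simps[of \<phi> xs])
qed

lemma boolean_cumulant_unique:
  assumes K: "\<And>xs. xs \<noteq> [] \<Longrightarrow> \<phi> (prod_list xs) =
      (\<Sum>\<pi>\<in>interval_partitions (length xs). \<Prod>B\<in>\<pi>. K (nths xs B))"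
    and "xs \<noteq> []"
  shows "K xs = boolean_cumulant \<phi> xs"
  using \<open>xs \<noteq> []\<close>
proof (induction xs rule: length_induct)
  case (1 xs)
  let ?n = "length xs"
  have eq: "K (nths xs B) = boolean_cumulant \<phi> (nths xs B)"
    if "\<pi> \<in> interval_partitions ?n - {{{..<?n}}}" "B \<in> \<pi>" for \<pi> B
  proof -
    have p: "partition_on {..<?n} \<pi>"
      using that by (simp add: interval_partitions_def)
    then have "B \<noteq> {}" "B \<subseteq> {..<?n}"
      using that(2) by (auto simp: partition_on_def)
    then have "set (nths xs B) \<noteq> {}"
      by (auto simp: set_nths)
    then have "nths xs B \<noteq> []"
      by auto
    with 1 length_nths_less[OF that] show ?thesis
      by blast
  qed
  have "nths xs {..<?n} = xs"
    by (simp add: nths_all)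
  then have "\<phi> (prod_list xs) =
      K xs + (\<Sum>\<pi>\<in>interval_partitions ?n - {{{..<?n}}}. \<Prod>B\<in>\<pi>. K (nths xs B))"
    using K[OF \<open>xs \<noteq> []\<close>] \<open>xs \<noteq> []\<close>
    by (subst (asm) sum.remove[OF finite_interval_partitions full_interval_partition]) auto
  also have "(\<Sum>\<pi>\<in>interval_partitions ?n - {{{..<?n}}}. \<Prod>B\<in>\<pi>. K (nths xs B)) =
      (\<Sum>\<pi>\<in>interval_partitions ?n - {{{..<?n}}}. \<Prod>B\<in>\<pi>. boolean_cumulant \<phi> (nths xs B))"
    by (intro sum.cong prod.cong refl eq)
  finally show ?case
    by (simp add: boolean_cumulant.simps[of \<phi> xs])
qed

definition boolean_cumulant_of :: "('a::ring_1 \<Rightarrow> complex) \<Rightarrow> nat \<Rightarrow> 'a \<Rightarrow> complex" where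
  "boolean_cumulant_of \<phi> r X = boolean_cumulant \<phi> (replicate r X)"

definition identically_distributed :: "('a::ring_1 \<Rightarrow> complex) \<Rightarrow> 'a \<Rightarrow> 'a \<Rightarrow> bool" where
  "identically_distributed \<phi> X Y \<longleftrightarrow>
     (\<forall>r\<ge>1. boolean_cumulant_of \<phi> r X = boolean_cumulant_of \<phi> r Y)"

definition boolean_gaussian :: "('a::ring_1 \<Rightarrow> complex) \<Rightarrow> 'a \<Rightarrow> bool" where
  "boolean_gaussian \<phi> X \<longleftrightarrow> (\<forall>r>2. boolean_cumulant_of \<phi> r X = 0)"


section \<open>The sums of squares\<close>

definition shifted_square_sum ::
    "(complex \<Rightarrow> 'a::ring_1 \<Rightarrow> 'a) \<Rightarrow> nat \<Rightarrow> (nat \<Rightarrow> 'a) \<Rightarrow> (nat \<Rightarrow> real) \<Rightarrow> 'a" where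
  "shifted_square_sum scale n X a = (\<Sum>i=1..n. (X i + scale (of_real (a i)) 1)\<^sup>2)"

end

theory Submission
  imports Defs
begin

text \<open>
  Expanding the squares gives \<open>P = s + Q\<^sub>1 + \<dots> + Q\<^sub>n\<close> with \<open>s = \<Sum>i. a\<^sub>i\<^sup>2\<close> and
  \<open>Q\<^sub>i = X\<^sub>i\<^sup>2 + 2 a\<^sub>i X\<^sub>i\<close>.  The unit is not Boolean independent of the \<open>X\<^sub>i\<close>, so the constant \<open>s\<close>
  cannot be treated as one more independent summand.  But for fixed \<open>s\<close> the moments of \<open>P\<close> and
  those of \<open>Q = Q\<^sub>1 + \<dots> + Q\<^sub>n\<close> determine each other, and each \<open>Q\<^sub>i\<close> lies in the (non-unital)
  algebra generated by \<open>X\<^sub>i\<close>, so the cumulants of \<open>Q\<close> are sums (\<open>cumulant_sum\<close>):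
  \<open>K\<^sub>r(Q) = f\<^sub>r(a\<^sub>1) + \<dots> + f\<^sub>r(a\<^sub>n)\<close>, where \<open>f\<^sub>r(a) = K\<^sub>r(X\<^sup>2 + 2 a X)\<close>.  The question is thus when
  all these sums depend on \<open>\<Sum>i. a\<^sub>i\<^sup>2\<close> only.

  If \<open>X\<close> is Boolean Gaussian, its moments are those of a fair sign, so that \<open>X\<^sup>2 + 2 a X\<close> behaves
  like \<open>1 \<plusminus> 2 a\<close>; hence \<open>f\<^sub>1(a) = 1\<close> and \<open>f\<^sub>r(a) = 4 a\<^sup>2\<close> for \<open>r \<ge> 2\<close>
  (\<open>gaussian_cumulant_quadratic\<close>), and the sums have the required form.

  Conversely, comparing the shifts \<open>(a, a, 0, \<dots>)\<close> and \<open>(\<surd>2 a, 0, 0, \<dots>)\<close> gives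
  \<open>2 f\<^sub>r(a) = f\<^sub>r(\<surd>2 a) + f\<^sub>r(0)\<close>.  By homogeneity of the cumulants
  \<open>f\<^sub>r(a) / a\<^sup>r = K\<^sub>r(X\<^sup>2 / a + 2 X)\<close>, which tends to \<open>2\<^sup>r K\<^sub>r(X)\<close> as \<open>a \<rightarrow> \<infinity>\<close>
  (\<open>cumulant_quadratic_tendsto\<close>).  Dividing the identity by \<open>a\<^sup>r\<close> and passing to the limit yields
  \<open>2 K\<^sub>r(X) = (\<surd>2)\<^sup>r K\<^sub>r(X)\<close>, and so \<open>K\<^sub>r(X) = 0\<close> whenever \<open>r > 2\<close>.

  All of this uses the moment-cumulant formula in its recursive form
  \<open>m\<^sub>n = \<Sum>k=1..n. K\<^sub>k m\<^bsub>n-k\<^esub>\<close>, which arises by splitting off the first block of an interval partition.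
\<close>

section \<open>The first block of an interval partition\<close>

lemma partition_on_inj_map:
  assumes "partition_on A P" "inj_on f A"
  shows "partition_on (f ` A) ((`) f ` P)"
proof -
  have "{} \<notin> (`) f ` P"
    using assms(1) by (auto simp: partition_on_def)
  then show ?thesis
    using partition_on_inj_image[OF assms] by simp
qed

definition prepend_block :: "nat \<Rightarrow> nat set set \<Rightarrow> nat set set" where
  "prepend_block b \<sigma> = insert {..<b} ((`) ((+) b) ` \<sigma>)"

lemma zero_notin_shifted: "b > 0 \<Longrightarrow> B \<in> (`) ((+) b) ` \<sigma> \<Longrightarrow> (0::nat) \<notin> B"
  by auto

lemma first_block_notin_shifted: "b > 0 \<Longrightarrow> {..<b} \<notin> (`) ((+) (b::nat)) ` \<sigma>"
  using zero_notin_shifted by blast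

lemma interval_partition_prepend_block:
  assumes b: "b \<in> {1..n}" and \<sigma>: "\<sigma> \<in> interval_partitions (n - b)"
  shows "prepend_block b \<sigma> \<in> interval_partitions n"
proof -
  have p: "partition_on {..<n - b} \<sigma>" and i: "\<And>B. B \<in> \<sigma> \<Longrightarrow> \<exists>c d. B = {c..<d}"
    using \<sigma> by (auto simp: interval_partitions_def)
  have im: "(+) b ` {c..<d} = {c + b..<d + b}" for c d
    by (rule image_add_atLeastLessThan)
  have "partition_on ((+) b ` {..<n - b}) ((`) ((+) b) ` \<sigma>)"
    using p by (rule partition_on_inj_map) simp
  also have "(+) b ` {..<n - b} = {..<n} - {..<b}"
    using b im[of 0 "n - b"] by (auto simp: lessThan_atLeast0)
  finally have q: "partition_on ({..<n} - {..<b}) ((`) ((+) b) ` \<sigma>)" .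
  have "disjnt {..<b} (\<Union> ((`) ((+) b) ` \<sigma>))"
    by (auto simp: disjnt_def)
  from partition_on_insert[OF this, of "{..<n}"] have "partition_on {..<n} (prepend_block b \<sigma>)"
    using q b by (simp add: prepend_block_def lessThan_empty_iff)
  moreover have "\<exists>c d. B = {c..<d}" if "B \<in> prepend_block b \<sigma>" for B
  proof (cases "B = {..<b}")
    case False
    with that obtain C where "C \<in> \<sigma>" "B = (+) b ` C"
      by (auto simp: prepend_block_def)
    with i im show ?thesis
      by metis
  qed (use lessThan_atLeast0 in blast)
  ultimately show ?thesis
    unfolding interval_partitions_def by blast
qed

lemma interval_partition_first_block:
  assumes "n > 0" and \<pi>: "\<pi> \<in> interval_partitions n"
  shows "\<exists>b \<sigma>. b \<in> {1..n} \<and> \<sigma> \<in> interval_partitions (n - b) \<and> \<pi> = prepend_block b \<sigma>"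
proof -
  have p: "partition_on {..<n} \<pi>" and i: "\<And>B. B \<in> \<pi> \<Longrightarrow> \<exists>c d. B = {c..<d}"
    using \<pi> by (auto simp: interval_partitions_def)
  have "0 \<in> \<Union>\<pi>"
    using p assms(1) by (auto simp: partition_on_def)
  then obtain B where B: "B \<in> \<pi>" "0 \<in> B"
    by blast
  then obtain c b where "B = {c..<b}"
    using i by blast
  then have b: "B = {..<b}" "b > 0"
    using B(2) by auto
  have "B \<subseteq> {..<n}"
    using p B(1) by (auto simp: partition_on_def)
  then have bn: "b \<in> {1..n}"
    using b by auto
  define \<rho> where "\<rho> = \<pi> - {B}"
  have \<pi>_eq: "\<pi> = insert {..<b} \<rho>"
    using B(1) b by (auto simp: \<rho>_def)
  have "disjnt {..<b} (\<Union>\<rho>)"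
    using partition_onD2[OF p] B(1) unfolding b(1)[symmetric] \<rho>_def
    by (auto simp: disjoint_def disjnt_def)
  from partition_on_insert[OF this] have r: "partition_on ({..<n} - {..<b}) \<rho>"
    using p unfolding \<pi>_eq by blast
  let ?g = "\<lambda>x. x - b"
  define \<sigma> where "\<sigma> = (`) ?g ` \<rho>"
  have ge: "x \<ge> b" if "C \<in> \<rho>" "x \<in> C" for C x
    using partition_onD1[OF r] that by (metis DiffD2 UnionI lessThan_iff not_le)
  have "partition_on (?g ` ({..<n} - {..<b})) \<sigma>"
    unfolding \<sigma>_def using r by (rule partition_on_inj_map) (auto simp: inj_on_def)
  also have "?g ` ({..<n} - {..<b}) = {..<n - b}"
  proof (intro equalityI subsetI)
    fix x assume "x \<in> {..<n - b}"
    then show "x \<in> ?g ` ({..<n} - {..<b})"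
      by (intro image_eqI[of _ _ "x + b"]) auto
  qed auto
  finally have s: "partition_on {..<n - b} \<sigma>" .
  have "\<exists>c d. ?g ` C = {c..<d}" if C: "C \<in> \<rho>" for C
  proof -
    have "C \<in> \<pi>"
      using C by (simp add: \<rho>_def)
    then obtain c d where "C = {c..<d}"
      using i by blast
    then show ?thesis
      unfolding image_minus_const_atLeastLessThan_nat[of b c d, folded \<open>C = {c..<d}\<close>]
      by (metis atLeastLessThan_singleton atLeastLessThan_empty_iff2)
  qed
  then have "\<sigma> \<in> interval_partitions (n - b)"
    using s unfolding interval_partitions_def \<sigma>_def by blast
  moreover have "(+) b ` ?g ` C = C" if "C \<in> \<rho>" for C
    using ge[OF that] by (force simp: image_image)
  then have "(`) ((+) b) ` \<sigma> = \<rho>"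
    by (simp add: \<sigma>_def image_image)
  then have "\<pi> = prepend_block b \<sigma>"
    by (simp add: \<pi>_eq prepend_block_def)
  ultimately show ?thesis
    using bn by blast
qed

lemma prepend_block_inject:
  assumes eq: "prepend_block b \<sigma> = prepend_block c \<tau>" and pos: "b > 0" "c > 0"
  shows "b = c \<and> \<sigma> = \<tau>"
proof -
  have "{..<b} \<in> prepend_block c \<tau>"
    unfolding eq[symmetric] by (simp add: prepend_block_def)
  moreover have "0 \<in> {..<b}"
    using pos by simp
  ultimately have "{..<b} = {..<c}"
    using zero_notin_shifted[OF pos(2)] unfolding prepend_block_def by blast
  then have bc: "b = c"
    by simp
  have "(`) ((+) b) ` \<sigma> = (`) ((+) b) ` \<tau>"
    using eq first_block_notin_shifted[OF pos(1)] unfolding bc prepend_block_def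
    by (simp add: insert_ident)
  moreover have "inj ((`) ((+) b))"
    by (rule injI) (simp add: inj_image_eq_iff)
  ultimately show ?thesis
    using bc by (simp add: inj_image_eq_iff)
qed

text \<open>
  A nonempty interval partition is its first block, which is some \<open>{..<b}\<close>, followed by an
  arbitrary interval partition of the remaining points; \<open>b\<close> can be read off as the length of the
  only block that contains \<open>0\<close>.
\<close>

lemma bij_betw_prepend_block:
  assumes "n > 0"
  shows "bij_betw (\<lambda>(b, \<sigma>). prepend_block b \<sigma>)
    (SIGMA b:{1..n}. interval_partitions (n - b)) (interval_partitions n)"
proof (rule bij_betw_imageI)
  show "inj_on (\<lambda>(b, \<sigma>). prepend_block b \<sigma>) (SIGMA b:{1..n}. interval_partitions (n - b))"
    by (rule inj_onI) (auto dest: prepend_block_inject)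
  show "(\<lambda>(b, \<sigma>). prepend_block b \<sigma>) ` (SIGMA b:{1..n}. interval_partitions (n - b)) =
      interval_partitions n"
    using interval_partition_prepend_block interval_partition_first_block[OF assms]
    by (fastforce simp: image_iff)
qed

text \<open>
  The blocks after the first one select their entries from \<open>drop b xs\<close>, so the sum over
  \<open>\<sigma>\<close> is again the partition sum of a list, and the moment-cumulant formula becomes a recursion.
\<close>

lemma sum_interval_partitions_first_block:
  fixes K :: "'b list \<Rightarrow> 'c::comm_semiring_1"
  assumes "xs \<noteq> []"
  shows "(\<Sum>\<pi>\<in>interval_partitions (length xs). \<Prod>B\<in>\<pi>. K (nths xs B)) =
    (\<Sum>b=1..length xs. K (take b xs) *
       (\<Sum>\<sigma>\<in>interval_partitions (length xs - b). \<Prod>B\<in>\<sigma>. K (nths (drop b xs) B)))"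
proof -
  let ?n = "length xs"
  have block: "(\<Prod>B\<in>prepend_block b \<sigma>. K (nths xs B)) =
      K (take b xs) * (\<Prod>B\<in>\<sigma>. K (nths (drop b xs) B))"
    if b: "b \<in> {1..?n}" and \<sigma>: "\<sigma> \<in> interval_partitions (?n - b)" for b \<sigma>
  proof -
    have fin: "finite \<sigma>"
      using \<sigma> by (auto simp: interval_partitions_def intro: finite_elements[rotated])
    have "{..<b} \<notin> (`) ((+) b) ` \<sigma>"
      using b by (intro first_block_notin_shifted) simp
    then have "(\<Prod>B\<in>prepend_block b \<sigma>. K (nths xs B)) =
        K (nths xs {..<b}) * (\<Prod>B\<in>(`) ((+) b) ` \<sigma>. K (nths xs B))"
      using fin by (simp add: prepend_block_def)
    also have "(\<Prod>B\<in>(`) ((+) b) ` \<sigma>. K (nths xs B)) = (\<Prod>B\<in>\<sigma>. K (nths xs ((+) b ` B)))"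
      by (subst prod.reindex) (auto simp: inj_on_def inj_image_eq_iff)
    also have "\<dots> = (\<Prod>B\<in>\<sigma>. K (nths (drop b xs) B))"
    proof (rule prod.cong[OF refl])
      fix B
      have len: "length (take b xs) = b"
        using b by simp
      have "set (nths (take b xs) ((+) b ` B)) = {}"
        unfolding set_nths len by auto
      moreover have "{j. j + b \<in> (+) b ` B} = B"
        by (auto simp: add.commute)
      ultimately have "nths (take b xs @ drop b xs) ((+) b ` B) = nths (drop b xs) B"
        unfolding nths_append len by simp
      then show "K (nths xs ((+) b ` B)) = K (nths (drop b xs) B)"
        by simp
    qed
    finally show ?thesis
      by (simp only: nths_upt_eq_take)
  qed
  have "(\<Sum>\<pi>\<in>interval_partitions ?n. \<Prod>B\<in>\<pi>. K (nths xs B)) =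
      (\<Sum>(b, \<sigma>)\<in>(SIGMA b:{1..?n}. interval_partitions (?n - b)).
         \<Prod>B\<in>prepend_block b \<sigma>. K (nths xs B))"
    using sum.reindex_bij_betw[OF bij_betw_prepend_block, of ?n "\<lambda>\<pi>. \<Prod>B\<in>\<pi>. K (nths xs B)"] assms
    by (simp add: case_prod_unfold)
  also have "\<dots> = (\<Sum>b=1..?n. \<Sum>\<sigma>\<in>interval_partitions (?n - b).
      \<Prod>B\<in>prepend_block b \<sigma>. K (nths xs B))"
    by (rule sum.Sigma[symmetric]) (auto simp: finite_interval_partitions)
  also have "\<dots> = (\<Sum>b=1..?n. \<Sum>\<sigma>\<in>interval_partitions (?n - b).
      K (take b xs) * (\<Prod>B\<in>\<sigma>. K (nths (drop b xs) B)))"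
    by (intro sum.cong refl block)
  finally show ?thesis
    by (simp add: sum_distrib_left)
qed

lemma interval_partitions_0: "interval_partitions 0 = {{}}"
  by (auto simp: interval_partitions_def partition_on_def)

lemma moment_first_block:
  assumes "\<phi> 1 = 1" and "xs \<noteq> []"
  shows "\<phi> (prod_list xs) =
    (\<Sum>b=1..length xs. boolean_cumulant \<phi> (take b xs) * \<phi> (prod_list (drop b xs)))"
proof -
  have "(\<Sum>\<sigma>\<in>interval_partitions (length ys). \<Prod>B\<in>\<sigma>. boolean_cumulant \<phi> (nths ys B)) =
      \<phi> (prod_list ys)" for ys
    using moment_cumulant[of ys \<phi>] assms(1)
    by (cases "ys = []") (simp_all add: interval_partitions_0)
  from this[of "drop _ xs"] show ?thesis
    unfolding moment_cumulant[OF assms(2)] sum_interval_partitions_first_block[OF assms(2)]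
    by simp
qed


section \<open>Moment and cumulant sequences\<close>

text \<open>
  For the generating functions \<open>M(z) = \<Sum>n. \<mu> n z\<^sup>n\<close> and \<open>K(z) = \<Sum>n\<ge>1. \<kappa> n z\<^sup>n\<close> this is the
  equation \<open>M = 1 + K M\<close>.  The value \<open>\<kappa> 0\<close> is left free.
\<close>

definition moment_cumulant_sequences :: "(nat \<Rightarrow> 'b::comm_ring_1) \<Rightarrow> (nat \<Rightarrow> 'b) \<Rightarrow> bool" where
  "moment_cumulant_sequences \<mu> \<kappa> \<longleftrightarrow>
     \<mu> 0 = 1 \<and> (\<forall>n. \<mu> (Suc n) = (\<Sum>k\<le>n. \<kappa> (Suc k) * \<mu> (n - k)))"

lemma moment_cumulant_sequences_last:
  assumes "moment_cumulant_sequences \<mu> \<kappa>"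
  shows "\<kappa> (Suc n) = \<mu> (Suc n) - (\<Sum>k<n. \<kappa> (Suc k) * \<mu> (n - k))"
  using assms by (simp add: moment_cumulant_sequences_def lessThan_Suc_atMost[symmetric])

lemma boolean_moment_cumulant_sequences:
  assumes "\<phi> 1 = 1"
  shows "moment_cumulant_sequences (\<lambda>r. \<phi> (Y ^ r)) (\<lambda>r. boolean_cumulant_of \<phi> r Y)"
  unfolding moment_cumulant_sequences_def
proof (intro conjI allI)
  fix n
  have "\<phi> (Y ^ Suc n) = \<phi> (prod_list (replicate (Suc n) Y))"
    by (simp only: prod_list_replicate)
  also have "\<dots> = (\<Sum>b=1..Suc n. boolean_cumulant \<phi> (take b (replicate (Suc n) Y)) *
      \<phi> (prod_list (drop b (replicate (Suc n) Y))))"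
    using moment_first_block[of \<phi> "replicate (Suc n) Y", OF assms] by simp
  also have "\<dots> = (\<Sum>k<Suc n. boolean_cumulant_of \<phi> (Suc k) Y * \<phi> (Y ^ (n - k)))"
    unfolding One_nat_def sum.atLeast1_atMost_eq
    by (intro sum.cong refl)
       (simp add: boolean_cumulant_of_def take_replicate drop_replicate prod_list_replicate
          min_def del: replicate_Suc)
  finally show "\<phi> (Y ^ Suc n) = (\<Sum>k\<le>n. boolean_cumulant_of \<phi> (Suc k) Y * \<phi> (Y ^ (n - k)))"
    by (simp only: lessThan_Suc_atMost)
qed (simp add: assms)

lemma moments_determine_cumulants:
  assumes "moment_cumulant_sequences \<mu> \<kappa>" "moment_cumulant_sequences \<mu> \<kappa>'"
  shows "\<kappa> (Suc n) = \<kappa>' (Suc n)"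
proof (induction n rule: less_induct)
  case (less n)
  then show ?case
    by (simp add: moment_cumulant_sequences_last[OF assms(1), of n]
        moment_cumulant_sequences_last[OF assms(2), of n])
qed

lemma cumulants_determine_moments:
  assumes "moment_cumulant_sequences \<mu> \<kappa>" "moment_cumulant_sequences \<mu>' \<kappa>'"
    and eq: "\<And>r. r \<ge> 1 \<Longrightarrow> \<kappa> r = \<kappa>' r"
  shows "\<mu> n = \<mu>' n"
proof (induction n rule: less_induct)
  case (less n)
  then show ?case
    using assms(1,2) eq by (cases n) (auto simp: moment_cumulant_sequences_def intro!: sum.cong)
qed

lemma identically_distributed_iff_moments:
  assumes "\<phi> 1 = 1"
  shows "identically_distributed \<phi> Y Z \<longleftrightarrow> (\<forall>r. \<phi> (Y ^ r) = \<phi> (Z ^ r))"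
proof
  assume "identically_distributed \<phi> Y Z"
  then show "\<forall>r. \<phi> (Y ^ r) = \<phi> (Z ^ r)"
    using cumulants_determine_moments[OF boolean_moment_cumulant_sequences[of \<phi> Y, OF assms]
        boolean_moment_cumulant_sequences[of \<phi> Z, OF assms]]
    by (auto simp: identically_distributed_def)
next
  assume m: "\<forall>r. \<phi> (Y ^ r) = \<phi> (Z ^ r)"
  have "boolean_cumulant_of \<phi> (Suc r) Y = boolean_cumulant_of \<phi> (Suc r) Z" for r
    using moments_determine_cumulants[OF boolean_moment_cumulant_sequences[of \<phi> Y, OF assms],
        of "\<lambda>r. boolean_cumulant_of \<phi> r Z"]
      boolean_moment_cumulant_sequences[of \<phi> Z, OF assms] m
    by simp
  then show "identically_distributed \<phi> Y Z"
    unfolding identically_distributed_def by (metis Suc_pred' less_eq_Suc_le One_nat_def)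
qed

lemma moment_cumulant_sequences_scale:
  assumes "moment_cumulant_sequences \<mu> \<kappa>"
  shows "moment_cumulant_sequences (\<lambda>r. c ^ r * \<mu> r) (\<lambda>r. c ^ r * \<kappa> r)"
  unfolding moment_cumulant_sequences_def
proof (intro conjI allI)
  fix n
  have "c ^ Suc n * (\<kappa> (Suc k) * \<mu> (n - k)) = c ^ Suc k * \<kappa> (Suc k) * (c ^ (n - k) * \<mu> (n - k))"
    if "k \<le> n" for k
  proof -
    have "c ^ Suc n = c ^ Suc k * c ^ (n - k)"
      using that unfolding power_add[symmetric] by simp
    then show ?thesis
      by (simp only: mult_ac)
  qed
  then show "c ^ Suc n * \<mu> (Suc n) =
      (\<Sum>k\<le>n. c ^ Suc k * \<kappa> (Suc k) * (c ^ (n - k) * \<mu> (n - k)))"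
    using assms by (simp add: moment_cumulant_sequences_def sum_distrib_left del: power_Suc)
qed (use assms in \<open>simp add: moment_cumulant_sequences_def\<close>)

text \<open>
  Each cumulant is a polynomial in finitely many moments, and therefore continuous in them.
\<close>

lemma tendsto_cumulants:
  fixes \<mu> :: "'t \<Rightarrow> nat \<Rightarrow> complex"
  assumes "\<forall>\<^sub>F t in F. moment_cumulant_sequences (\<mu> t) (\<kappa> t)" "moment_cumulant_sequences \<mu>\<^sub>0 \<kappa>\<^sub>0"
    and lim: "\<And>r. ((\<lambda>t. \<mu> t r) \<longlongrightarrow> \<mu>\<^sub>0 r) F"
  shows "((\<lambda>t. \<kappa> t (Suc n)) \<longlongrightarrow> \<kappa>\<^sub>0 (Suc n)) F"
proof (induction n rule: less_induct)
  case (less n)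
  have "((\<lambda>t. \<mu> t (Suc n) - (\<Sum>k<n. \<kappa> t (Suc k) * \<mu> t (n - k))) \<longlongrightarrow>
      \<mu>\<^sub>0 (Suc n) - (\<Sum>k<n. \<kappa>\<^sub>0 (Suc k) * \<mu>\<^sub>0 (n - k))) F"
    by (intro tendsto_intros lim less.IH) simp
  moreover have "\<forall>\<^sub>F t in F. \<kappa> t (Suc n) = \<mu> t (Suc n) - (\<Sum>k<n. \<kappa> t (Suc k) * \<mu> t (n - k))"
    using assms(1) by eventually_elim (rule moment_cumulant_sequences_last)
  ultimately show ?case
    unfolding moment_cumulant_sequences_last[OF assms(2), of n]
    by (simp add: filterlim_cong[OF refl refl])
qed

context nc_probability_space
begin

lemma state_add: "\<phi> (x + y) = \<phi> x + \<phi> y"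
  and state_scale: "\<phi> (scale c x) = c * \<phi> x"
  and state_sum: "\<phi> (sum g A) = (\<Sum>i\<in>A. \<phi> (g i))"
proof -
  interpret L: Vector_Spaces.linear scale "(*)" \<phi>
    by (rule state_linear)
  show "\<phi> (x + y) = \<phi> x + \<phi> y" "\<phi> (scale c x) = c * \<phi> x" "\<phi> (sum g A) = (\<Sum>i\<in>A. \<phi> (g i))"
    by (rule L.add L.scale L.sum)+
qed

lemmas moments_cumulants = boolean_moment_cumulant_sequences[of \<phi>, OF state_one]
lemmas identically_distributed_iff = identically_distributed_iff_moments[of \<phi>, OF state_one]


section \<open>Additivity of the cumulants\<close>

text \<open>
  Words are lists of letters tagged with the index of their algebra.  The tags keep track of which
  neighbours come from different algebras, which the elements alone do not reveal.
\<close>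

definition is_word :: "'i set \<Rightarrow> ('i \<Rightarrow> 'a set) \<Rightarrow> ('i \<times> 'a) list \<Rightarrow> bool" where
  "is_word I B ps \<longleftrightarrow> ps \<noteq> [] \<and> (\<forall>(i, x)\<in>set ps. i \<in> I \<and> x \<in> B i)"

lemma state_alternating_word:
  assumes ind: "boolean_independent_algebras \<phi> I B"
    and ps: "\<forall>(i, x)\<in>set ps. i \<in> I \<and> x \<in> B i" "successively (\<lambda>p q. fst p \<noteq> fst q) ps"
  shows "\<phi> (prod_list (map snd ps)) = prod_list (map (\<phi> \<circ> snd) ps)"
proof -
  let ?i = "\<lambda>j. fst (ps ! (j - 1))" and ?x = "\<lambda>j. snd (ps ! (j - 1))"
  have "\<forall>j\<in>{1..length ps}. ?i j \<in> I \<and> ?x j \<in> B (?i j)"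
  proof
    fix j assume "j \<in> {1..length ps}"
    then have "ps ! (j - 1) \<in> set ps"
      by auto
    then show "?i j \<in> I \<and> ?x j \<in> B (?i j)"
      using ps(1) by (auto simp: case_prod_unfold)
  qed
  moreover have "\<forall>j\<in>{1..<length ps}. ?i j \<noteq> ?i (Suc j)"
  proof
    fix j assume "j \<in> {1..<length ps}"
    then show "?i j \<noteq> ?i (Suc j)"
      using ps(2) by (cases j) (auto simp: successively_conv_nth)
  qed
  ultimately have "\<phi> (prod_list (map ?x [1..<Suc (length ps)])) = (\<Prod>j=1..length ps. \<phi> (?x j))"
    using ind[unfolded boolean_independent_algebras_def, rule_format, of "length ps" ?i ?x] by blast
  moreover have "map ?x [1..<Suc (length ps)] = map snd ps"
    by (rule nth_equalityI) (auto simp del: upt_Suc)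
  moreover have "(\<Prod>j=1..length ps. \<phi> (?x j)) = (\<Prod>j<length ps. \<phi> (snd (ps ! j)))"
    by (rule prod.reindex_bij_witness[of _ Suc "\<lambda>j. j - 1"]) auto
  ultimately show ?thesis
    by (simp add: prod.list_conv_set_nth lessThan_atLeast0)
qed

text \<open>
  Multiplying neighbouring letters of the same algebra makes a word alternating, without changing
  its product or the algebra of its first letter.
\<close>

lemma word_reduce:
  assumes mult: "\<And>i x y. i \<in> I \<Longrightarrow> x \<in> B i \<Longrightarrow> y \<in> B i \<Longrightarrow> x * y \<in> B i"
    and "is_word I B ps"
  shows "\<exists>qs. is_word I B qs \<and> successively (\<lambda>p q. fst p \<noteq> fst q) qs \<and>
    fst (hd qs) = fst (hd ps) \<and> prod_list (map snd qs) = prod_list (map snd ps)"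
  using assms(2)
proof (induction ps)
  case (Cons p ps)
  show ?case
  proof (cases "ps = []")
    case True
    with Cons.prems show ?thesis
      by (intro exI[of _ "[p]"]) auto
  next
    case False
    then have "is_word I B ps"
      using Cons.prems by (auto simp: is_word_def)
    from Cons.IH[OF this] obtain rs where rs: "is_word I B rs"
      "successively (\<lambda>p q. fst p \<noteq> fst q) rs" "prod_list (map snd rs) = prod_list (map snd ps)"
      by blast
    then obtain q qs where "rs = q # qs"
      by (cases rs) (auto simp: is_word_def)
    note qs = rs[unfolded this]
    show ?thesis
    proof (cases "fst p = fst q")
      case True
      let ?r = "(fst p, snd p * snd q)"
      have "is_word I B (?r # qs)"
        using qs(1) Cons.prems True mult by (auto simp: is_word_def case_prod_unfold)
      moreover have "successively (\<lambda>p q. fst p \<noteq> fst q) (?r # qs)"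
        using qs(2) True by (auto simp: successively_Cons)
      ultimately show ?thesis
        using qs(3) by (intro exI[of _ "?r # qs"]) (simp add: mult.assoc)
    next
      case False
      then show ?thesis
        using qs Cons.prems
        by (intro exI[of _ "p # q # qs"]) (auto simp: is_word_def)
    qed
  qed
qed (simp add: is_word_def)

text \<open>
  Independence speaks of alternating products only.  Splitting off a single letter is possible for
  arbitrary words, because reducing the remaining word does not change its first algebra.
\<close>

lemma state_letter_word:
  assumes ind: "boolean_independent_algebras \<phi> I B"
    and mult: "\<And>i x y. i \<in> I \<Longrightarrow> x \<in> B i \<Longrightarrow> y \<in> B i \<Longrightarrow> x * y \<in> B i"
    and x: "i \<in> I" "x \<in> B i"
    and ps: "is_word I B ps" "fst (hd ps) \<noteq> i"
  shows "\<phi> (x * prod_list (map snd ps)) = \<phi> x * \<phi> (prod_list (map snd ps))"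
proof -
  obtain qs where qs: "is_word I B qs" "successively (\<lambda>p q. fst p \<noteq> fst q) qs"
    "fst (hd qs) = fst (hd ps)" "prod_list (map snd qs) = prod_list (map snd ps)"
    using word_reduce[of I B ps] mult ps(1) by blast
  have "\<phi> (prod_list (map snd ((i, x) # qs))) = prod_list (map (\<phi> \<circ> snd) ((i, x) # qs))"
    by (rule state_alternating_word[OF ind])
       (use qs x ps in \<open>auto simp: is_word_def successively_Cons\<close>)
  moreover have "\<phi> (prod_list (map snd qs)) = prod_list (map (\<phi> \<circ> snd) qs)"
    by (rule state_alternating_word[OF ind]) (use qs in \<open>auto simp: is_word_def\<close>)
  ultimately show ?thesis
    using qs(4) by simp
qed

text \<open>
  Multiplying out a power of the sum on the right appends letters to the word and leaves its first
  letter alone.  A nonempty word in front is essential: the sum itself contains a letter from the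
  algebra of \<open>x\<close>.
\<close>

lemma state_letter_word_power:
  assumes ind: "boolean_independent_algebras \<phi> I B"
    and mult: "\<And>i x y. i \<in> I \<Longrightarrow> x \<in> B i \<Longrightarrow> y \<in> B i \<Longrightarrow> x * y \<in> B i"
    and Y: "\<And>i. i \<in> I \<Longrightarrow> Y i \<in> B i"
    and x: "i \<in> I" "x \<in> B i"
    and ps: "is_word I B ps" "fst (hd ps) \<noteq> i"
  shows "\<phi> (x * (prod_list (map snd ps) * sum Y I ^ m)) =
    \<phi> x * \<phi> (prod_list (map snd ps) * sum Y I ^ m)"
  using ps
proof (induction m arbitrary: ps)
  case 0
  then show ?case
    using state_letter_word[OF ind mult x] by simp
next
  case (Suc m)
  let ?ps = "\<lambda>j. ps @ [(j, Y j)]"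
  have split: "prod_list (map snd ps) * sum Y I ^ Suc m =
      (\<Sum>j\<in>I. prod_list (map snd (?ps j)) * sum Y I ^ m)"
    by (simp add: mult.assoc sum_distrib_left sum_distrib_right)
  have "\<phi> (x * (prod_list (map snd (?ps j)) * sum Y I ^ m)) =
      \<phi> x * \<phi> (prod_list (map snd (?ps j)) * sum Y I ^ m)" if "j \<in> I" for j
    using Suc.prems that Y by (intro Suc.IH) (auto simp: is_word_def)
  then show ?case
    unfolding split by (simp add: sum_distrib_left state_sum)
qed

text \<open>
  This refines the moment recursion: it removes an initial run of \<open>k\<close> letters \<open>Y i\<close>, weighted by
  the cumulant \<open>\<kappa> k\<close> of \<open>Y i\<close> alone.  The first sum collects the runs inside the given power of
  \<open>Y i\<close>, the second those that reach into the power of \<open>S\<close>.  No run mixes different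
  algebras, which is how mixed cumulants vanish.  The induction on \<open>m\<close> turns one factor \<open>S\<close> at
  a time into either another \<open>Y i\<close>, which is covered by the induction hypothesis for \<open>p + 1\<close>,
  or some \<open>Y j\<close> with \<open>j \<noteq> i\<close>; in front of that \<open>Y j\<close> independence splits the state into two
  factors, and the recursion for \<open>Y i\<close> alone applies to the first.
\<close>

lemma state_power_sum_power:
  assumes ind: "boolean_independent_algebras \<phi> I B"
    and mult: "\<And>i x y. i \<in> I \<Longrightarrow> x \<in> B i \<Longrightarrow> y \<in> B i \<Longrightarrow> x * y \<in> B i"
    and Y: "\<And>i. i \<in> I \<Longrightarrow> Y i \<in> B i"
    and I: "finite I" "i \<in> I"
  defines "S \<equiv> sum Y I" and "\<kappa> \<equiv> \<lambda>r. boolean_cumulant_of \<phi> r (Y i)"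
  shows "\<phi> (Y i ^ Suc p * S ^ m) =
    (\<Sum>k\<le>p. \<kappa> (Suc k) * \<phi> (Y i ^ (p - k) * S ^ m)) +
    (\<Sum>k<m. \<kappa> (p + k + 2) * \<phi> (S ^ (m - Suc k)))"
proof (induction m arbitrary: p)
  case 0
  then show ?case
    using moments_cumulants[of "Y i"] by (simp add: moment_cumulant_sequences_def \<kappa>_def)
next
  case (Suc m)
  have pow: "Y i ^ Suc q \<in> B i" for q
    by (induction q) (use mult Y I in auto)
  have factor: "\<phi> (Y i ^ q * (Y j * S ^ m)) = \<phi> (Y i ^ q) * \<phi> (Y j * S ^ m)"
    if "j \<in> I - {i}" for q j
  proof (cases q)
    case (Suc q')
    then show ?thesis
      using state_letter_word_power[OF ind mult Y I(2) pow, of "[(j, Y j)]" q' m] that Y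
      by (auto simp: is_word_def S_def)
  qed (simp add: state_one)
  have split: "\<phi> (Y i ^ q * S ^ Suc m) = \<phi> (Y i ^ Suc q * S ^ m) +
      (\<Sum>j\<in>I - {i}. \<phi> (Y i ^ q * (Y j * S ^ m)))" for q
  proof -
    have "S = Y i + sum Y (I - {i})"
      unfolding S_def using I by (rule sum.remove)
    then have "S ^ Suc m = Y i * S ^ m + (\<Sum>j\<in>I - {i}. Y j * S ^ m)"
      by (metis distrib_right power_Suc sum_distrib_right)
    then have "Y i ^ q * S ^ Suc m = Y i ^ Suc q * S ^ m + (\<Sum>j\<in>I - {i}. Y i ^ q * (Y j * S ^ m))"
      by (simp add: distrib_left sum_distrib_left power_Suc2 mult.assoc del: power_Suc)
    then show ?thesis
      by (simp add: state_add state_sum)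
  qed
  have mom: "\<phi> (Y i ^ Suc p) = (\<Sum>k\<le>p. \<kappa> (Suc k) * \<phi> (Y i ^ (p - k)))"
    using moments_cumulants[of "Y i"]
    by (simp add: moment_cumulant_sequences_def \<kappa>_def del: power_Suc)
  have "\<phi> (Y i ^ Suc p * S ^ Suc m) = \<phi> (Y i ^ Suc (Suc p) * S ^ m) +
      (\<Sum>j\<in>I - {i}. \<phi> (Y i ^ Suc p * (Y j * S ^ m)))"
    by (rule split)
  also have "(\<Sum>j\<in>I - {i}. \<phi> (Y i ^ Suc p * (Y j * S ^ m))) =
      (\<Sum>j\<in>I - {i}. \<Sum>k\<le>p. \<kappa> (Suc k) * \<phi> (Y i ^ (p - k) * (Y j * S ^ m)))"
    by (intro sum.cong refl) (simp only: factor mom sum_distrib_right mult.assoc)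
  also have "\<dots> = (\<Sum>k\<le>p. \<kappa> (Suc k) * (\<Sum>j\<in>I - {i}. \<phi> (Y i ^ (p - k) * (Y j * S ^ m))))"
    by (subst sum.swap) (simp only: sum_distrib_left)
  also have "\<phi> (Y i ^ Suc (Suc p) * S ^ m) =
      (\<Sum>k\<le>Suc p. \<kappa> (Suc k) * \<phi> (Y i ^ (Suc p - k) * S ^ m)) +
      (\<Sum>k<m. \<kappa> (Suc p + k + 2) * \<phi> (S ^ (m - Suc k)))"
    by (rule Suc.IH)
  \<comment> \<open>The summand \<open>k = p + 1\<close> of the first sum has used up the power of \<open>Y i\<close> and becomes
      the summand \<open>k = 0\<close> of the second.\<close>
  also have "\<dots> = (\<Sum>k\<le>p. \<kappa> (Suc k) * \<phi> (Y i ^ Suc (p - k) * S ^ m)) +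
      (\<Sum>k<Suc m. \<kappa> (p + k + 2) * \<phi> (S ^ (Suc m - Suc k)))"
    by (simp add: Suc_diff_le sum.lessThan_Suc_shift del: power_Suc sum.lessThan_Suc)
  finally show ?case
    by (simp only: split distrib_left sum.distrib add_ac)
qed

text \<open>
  Adding up the previous lemma with \<open>p = 0\<close> over \<open>i\<close> shows that the sums of the cumulants
  satisfy the recursion that characterises the cumulants of the sum.
\<close>

lemma cumulant_sum:
  assumes ind: "boolean_independent_algebras \<phi> I B"
    and mult: "\<And>i x y. i \<in> I \<Longrightarrow> x \<in> B i \<Longrightarrow> y \<in> B i \<Longrightarrow> x * y \<in> B i"
    and Y: "\<And>i. i \<in> I \<Longrightarrow> Y i \<in> B i" and I: "finite I" and r: "r \<ge> 1"
  shows "boolean_cumulant_of \<phi> r (sum Y I) = (\<Sum>i\<in>I. boolean_cumulant_of \<phi> r (Y i))"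
proof -
  let ?S = "sum Y I" and ?\<kappa> = "\<lambda>i r. boolean_cumulant_of \<phi> r (Y i)"
  have "\<phi> (?S ^ Suc m) = (\<Sum>k\<le>m. (\<Sum>i\<in>I. ?\<kappa> i (Suc k)) * \<phi> (?S ^ (m - k)))" for m
  proof -
    have "\<phi> (Y i * ?S ^ m) = (\<Sum>k<Suc m. ?\<kappa> i (Suc k) * \<phi> (?S ^ (m - k)))" if "i \<in> I" for i
      using state_power_sum_power[OF ind mult Y I that, of 0 m]
      by (simp add: sum.lessThan_Suc_shift del: sum.lessThan_Suc)
    then have "\<phi> (?S ^ Suc m) = (\<Sum>i\<in>I. \<Sum>k\<le>m. ?\<kappa> i (Suc k) * \<phi> (?S ^ (m - k)))"
      by (simp add: sum_distrib_right state_sum lessThan_Suc_atMost)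
    also have "\<dots> = (\<Sum>k\<le>m. (\<Sum>i\<in>I. ?\<kappa> i (Suc k)) * \<phi> (?S ^ (m - k)))"
      by (subst sum.swap) (simp only: sum_distrib_right)
    finally show ?thesis .
  qed
  then have "moment_cumulant_sequences (\<lambda>r. \<phi> (?S ^ r)) (\<lambda>r. \<Sum>i\<in>I. ?\<kappa> i r)"
    by (simp add: moment_cumulant_sequences_def state_one)
  from moments_determine_cumulants[OF moments_cumulants this, of "r - 1"] show ?thesis
    using r by simp
qed


section \<open>Quadratic polynomials in one random variable\<close>

definition quadratic :: "complex \<Rightarrow> complex \<Rightarrow> complex \<Rightarrow> 'a \<Rightarrow> 'a" where
  "quadratic c d e Y = scale c (Y * Y) + scale d Y + scale e 1"

lemma state_power_quadratic_Suc:
  "\<phi> (Y ^ j * quadratic c d e Y ^ Suc r) =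
     c * \<phi> (Y ^ (j + 2) * quadratic c d e Y ^ r) + d * \<phi> (Y ^ (j + 1) * quadratic c d e Y ^ r) +
     e * \<phi> (Y ^ j * quadratic c d e Y ^ r)"
proof -
  let ?q = "quadratic c d e Y"
  have "Y ^ j * ?q ^ Suc r = (Y ^ j * ?q) * ?q ^ r"
    by (simp add: mult.assoc)
  also have "Y ^ j * ?q = scale c (Y ^ (j + 2)) + scale d (Y ^ (j + 1)) + scale e (Y ^ j)"
    by (simp add: quadratic_def distrib_left scale_mult_right power_add power2_eq_square
        power_Suc2 mult.assoc del: power_Suc)
  finally show ?thesis
    by (simp only: distrib_right scale_mult_left state_add state_scale)
qed

text \<open>
  The moments of a polynomial in \<open>Y\<close> depend on those of \<open>Y\<close> only.  The factor \<open>Y ^ j\<close> makes the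
  induction over the exponent of the polynomial self-contained.
\<close>

lemma moments_quadratic_cong:
  assumes "\<And>r. \<phi> (Y ^ r) = \<phi> (Z ^ r)"
  shows "\<phi> (quadratic c d e Y ^ r) = \<phi> (quadratic c d e Z ^ r)"
proof -
  have "\<phi> (Y ^ j * quadratic c d e Y ^ r) = \<phi> (Z ^ j * quadratic c d e Z ^ r)" for j
    by (induction r arbitrary: j) (simp_all only: state_power_quadratic_Suc assms power_0 mult_1_right)
  from this[of 0] show ?thesis
    by simp
qed

lemma cumulant_quadratic_cong:
  assumes "\<And>r. \<phi> (Y ^ r) = \<phi> (Z ^ r)" and "r \<ge> 1"
  shows "boolean_cumulant_of \<phi> r (quadratic c d e Y) = boolean_cumulant_of \<phi> r (quadratic c d e Z)"
proof -
  have "identically_distributed \<phi> (quadratic c d e Y) (quadratic c d e Z)"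
    using moments_quadratic_cong[OF assms(1)]
    by (simp add: identically_distributed_iff)
  with assms(2) show ?thesis
    by (simp add: identically_distributed_def)
qed

text \<open>
  After rescaling by \<open>1 / a\<close> the variable \<open>X\<^sup>2 + 2 a X\<close> becomes \<open>X\<^sup>2 / a + 2 X\<close>, whose moments
  converge to those of \<open>2 X\<close>.
\<close>

lemma cumulant_quadratic_tendsto:
  assumes "r \<ge> 1"
  shows "((\<lambda>a. boolean_cumulant_of \<phi> r (quadratic 1 (of_real (2 * a)) 0 X) / of_real (a ^ r))
    \<longlongrightarrow> 2 ^ r * boolean_cumulant_of \<phi> r X) at_top"
proof -
  let ?q = "\<lambda>a. quadratic 1 (of_real (2 * a)) 0 X"
  have inv: "((\<lambda>a. inverse (complex_of_real a)) \<longlongrightarrow> 0) at_top"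
    using tendsto_of_real[OF tendsto_inverse_0_at_top[OF filterlim_ident], where 'a = complex] by simp
  have mom: "((\<lambda>a. inverse (of_real a) ^ r * \<phi> (X ^ j * ?q a ^ r)) \<longlongrightarrow> 2 ^ r * \<phi> (X ^ (j + r))) at_top"
    for r j
  proof (induction r arbitrary: j)
    case (Suc r)
    let ?m = "\<lambda>j a. inverse (of_real a) ^ r * \<phi> (X ^ j * ?q a ^ r)"
    have "((\<lambda>a. inverse (of_real a) * ?m (j + 2) a + 2 * ?m (j + 1) a) \<longlongrightarrow>
        0 * (2 ^ r * \<phi> (X ^ (j + 2 + r))) + 2 * (2 ^ r * \<phi> (X ^ (j + 1 + r)))) at_top"
      by (intro tendsto_intros inv Suc.IH)
    moreover have "\<forall>\<^sub>F a in at_top. inverse (of_real a) * ?m (j + 2) a + 2 * ?m (j + 1) a =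
        inverse (of_real a) ^ Suc r * \<phi> (X ^ j * ?q a ^ Suc r)"
      using eventually_gt_at_top[of 0]
      by eventually_elim (simp only: state_power_quadratic_Suc, simp add: field_simps)
    ultimately have "((\<lambda>a. inverse (of_real a) ^ Suc r * \<phi> (X ^ j * ?q a ^ Suc r)) \<longlongrightarrow>
        0 * (2 ^ r * \<phi> (X ^ (j + 2 + r))) + 2 * (2 ^ r * \<phi> (X ^ (j + 1 + r)))) at_top"
      by (rule Lim_transform_eventually)
    then show ?case
      by (simp add: mult.assoc)
  qed simp
  have "((\<lambda>a. inverse (of_real a) ^ Suc n * boolean_cumulant_of \<phi> (Suc n) (?q a))
      \<longlongrightarrow> 2 ^ Suc n * boolean_cumulant_of \<phi> (Suc n) X) at_top" for n
  proof (rule tendsto_cumulants)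
    show "\<forall>\<^sub>F a in at_top. moment_cumulant_sequences (\<lambda>r. inverse (of_real a) ^ r * \<phi> (?q a ^ r))
        (\<lambda>r. inverse (of_real a) ^ r * boolean_cumulant_of \<phi> r (?q a))"
      by (intro always_eventually allI moment_cumulant_sequences_scale moments_cumulants)
    show "moment_cumulant_sequences (\<lambda>r. 2 ^ r * \<phi> (X ^ r)) (\<lambda>r. 2 ^ r * boolean_cumulant_of \<phi> r X)"
      by (intro moment_cumulant_sequences_scale moments_cumulants)
    show "((\<lambda>a. inverse (of_real a) ^ r * \<phi> (?q a ^ r)) \<longlongrightarrow> 2 ^ r * \<phi> (X ^ r)) at_top" for r
      using mom[of r 0] by simp
  qed
  from this[of "r - 1"] assms show ?thesis
    by (simp add: divide_inverse power_inverse mult.commute)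
qed

lemma gaussian_moment_Suc_Suc:
  assumes "boolean_gaussian \<phi> X" "boolean_cumulant_of \<phi> 1 X = 0" "boolean_cumulant_of \<phi> 2 X = 1"
  shows "\<phi> (X ^ Suc (Suc n)) = \<phi> (X ^ n)"
proof -
  have "\<phi> (X ^ Suc (Suc n)) = (\<Sum>k\<le>Suc n. boolean_cumulant_of \<phi> (Suc k) X * \<phi> (X ^ (Suc n - k)))"
    using moments_cumulants[of X] unfolding moment_cumulant_sequences_def by blast
  also have "\<dots> = (\<Sum>k\<in>{1}. boolean_cumulant_of \<phi> (Suc k) X * \<phi> (X ^ (Suc n - k)))"
  proof (rule sum.mono_neutral_right)
    have "boolean_cumulant_of \<phi> (Suc k) X = 0" if "k \<noteq> 1" for k
      using assms that by (cases "k = 0") (auto simp: boolean_gaussian_def)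
    then show "\<forall>k\<in>{..Suc n} - {1}. boolean_cumulant_of \<phi> (Suc k) X * \<phi> (X ^ (Suc n - k)) = 0"
      by auto
  qed auto
  finally show ?thesis
    using assms(3) by (simp add: numeral_2_eq_2)
qed

text \<open>
  The moments of \<open>X\<close> have period \<open>2\<close>, so inside the state \<open>X\<^sup>2\<close> acts as \<open>1\<close> and
  \<open>q = X\<^sup>2 + 2 a X\<close> as \<open>1 + 2 a X\<close>.  Multiplication by \<open>q\<close> therefore transforms the pair
  \<open>\<phi> (q ^ n)\<close>, \<open>\<phi> (X * q ^ n)\<close> linearly.  Solving the second component for the first
  gives a recursion for the moments of \<open>q\<close> from which its cumulants can be read off.
\<close>

lemma gaussian_cumulant_quadratic:
  assumes "boolean_gaussian \<phi> X" "boolean_cumulant_of \<phi> 1 X = 0" "boolean_cumulant_of \<phi> 2 X = 1"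
    and "r \<ge> 1"
  shows "boolean_cumulant_of \<phi> r (quadratic 1 (2 * a) 0 X) = (if r = 1 then 1 else 4 * a\<^sup>2)"
proof -
  let ?q = "quadratic 1 (2 * a) 0 X"
  have X1: "\<phi> X = 0"
    using moments_cumulants[of X] assms(2)
    unfolding moment_cumulant_sequences_def by (auto dest: spec[of _ 0])
  have period: "\<phi> (X ^ Suc (Suc j) * ?q ^ r) = \<phi> (X ^ j * ?q ^ r)" for j r
  proof (induction r arbitrary: j)
    case 0
    then show ?case
      using gaussian_moment_Suc_Suc[OF assms(1-3)] by simp
  next
    case (Suc r)
    show ?case
      using Suc.IH[of "j + 2"] Suc.IH[of "j + 1"]
      unfolding state_power_quadratic_Suc by (simp del: power_Suc)
  qed
  have even: "\<phi> (?q ^ Suc n) = \<phi> (?q ^ n) + 2 * a * \<phi> (X * ?q ^ n)" for n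
    using state_power_quadratic_Suc[of X 0 1 "2 * a" 0 n] period[of 0 n]
    by (simp add: numeral_2_eq_2 del: power_Suc)
  have odd_Suc: "\<phi> (X * ?q ^ Suc n) = \<phi> (X * ?q ^ n) + 2 * a * \<phi> (?q ^ n)" for n
    using state_power_quadratic_Suc[of X 1 1 "2 * a" 0 n] period[of 0 n] period[of 1 n]
    by (simp add: numeral_3_eq_3 numeral_2_eq_2 del: power_Suc)
  have odd: "\<phi> (X * ?q ^ n) = 2 * a * (\<Sum>k<n. \<phi> (?q ^ k))" for n
  proof (induction n)
    case (Suc n)
    then show ?case
      unfolding odd_Suc by (simp add: algebra_simps)
  qed (simp add: X1)
  have "\<phi> (?q ^ Suc n) = (\<Sum>k\<le>n. (if Suc k = 1 then 1 else 4 * a\<^sup>2) * \<phi> (?q ^ (n - k)))" for n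
  proof -
    have "(\<Sum>k\<le>n. (if Suc k = 1 then 1 else 4 * a\<^sup>2) * \<phi> (?q ^ (n - k))) =
        \<phi> (?q ^ n) + 4 * a\<^sup>2 * (\<Sum>k<n. \<phi> (?q ^ (n - Suc k)))"
      unfolding lessThan_Suc_atMost[symmetric] sum.lessThan_Suc_shift
      by (simp add: sum_distrib_left)
    also have "(\<Sum>k<n. \<phi> (?q ^ (n - Suc k))) = (\<Sum>k<n. \<phi> (?q ^ k))"
      by (rule sum.nat_diff_reindex)
    finally show ?thesis
      unfolding even odd by (simp add: power2_eq_square)
  qed
  then have "moment_cumulant_sequences (\<lambda>r. \<phi> (?q ^ r)) (\<lambda>r. if r = 1 then 1 else 4 * a\<^sup>2)"
    by (simp add: moment_cumulant_sequences_def state_one)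
  from moments_determine_cumulants[OF moments_cumulants this, of "r - 1"] assms(4) show ?thesis
    by simp
qed


section \<open>The shifted sums of squares\<close>

lemma subalgebra_generated: "subalgebra scale (generated_subalgebra scale S)"
  unfolding generated_subalgebra_def by (rule hull_in) (auto simp: subalgebra_def)

lemma quadratic_in_generated: "quadratic c d 0 Y \<in> generated_subalgebra scale {Y}"
proof -
  have "Y \<in> generated_subalgebra scale {Y}"
    unfolding generated_subalgebra_def by (rule hull_inc) simp
  with subalgebra_generated[of "{Y}"] show ?thesis
    by (simp add: subalgebra_def quadratic_def)
qed

definition nonconstant_part :: "nat \<Rightarrow> (nat \<Rightarrow> 'a) \<Rightarrow> (nat \<Rightarrow> real) \<Rightarrow> 'a" where
  "nonconstant_part n Xs a = (\<Sum>i=1..n. quadratic 1 (of_real (2 * a i)) 0 (Xs i))"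

lemma shifted_square_sum_eq:
  "shifted_square_sum scale n Xs a =
     quadratic 0 1 (of_real (\<Sum>i=1..n. (a i)\<^sup>2)) (nonconstant_part n Xs a)"
proof -
  have "(Y + scale (of_real c) 1)\<^sup>2 =
      quadratic 1 (of_real (2 * c)) 0 Y + scale (of_real (c\<^sup>2)) 1" for Y c
  proof -
    have "scale (2 * complex_of_real c) Y = scale (of_real c) Y + scale (of_real c) Y"
      by (simp flip: scale_left_distrib)
    then show ?thesis
      by (simp add: quadratic_def power2_eq_square distrib_left distrib_right scale_mult_left
          scale_mult_right scale_right_distrib)
  qed
  then show ?thesis
    by (simp add: shifted_square_sum_def nonconstant_part_def quadratic_def[of 0] sum.distrib
        scale_sum_left)
qed

text \<open>
  The two sums arise from their nonconstant parts by adding the same constant, and adding a constant to a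
  variable is undone by the polynomial that subtracts it.
\<close>

lemma identically_distributed_shifted_square_sum_iff:
  assumes "(\<Sum>i=1..n. (a i)\<^sup>2) = (\<Sum>i=1..n. (b i)\<^sup>2)"
  shows "identically_distributed \<phi> (shifted_square_sum scale n Xs a) (shifted_square_sum scale n Xs b)
    \<longleftrightarrow> identically_distributed \<phi> (nonconstant_part n Xs a) (nonconstant_part n Xs b)"
proof -
  define s where "s = complex_of_real (\<Sum>i=1..n. (a i)\<^sup>2)"
  have inverse: "quadratic 0 1 (- s) (quadratic 0 1 s Y) = Y" for Y
    by (simp add: quadratic_def)
  have same_moments: "(\<forall>r. \<phi> (quadratic 0 1 s Y ^ r) = \<phi> (quadratic 0 1 s Z ^ r)) \<longleftrightarrow> (\<forall>r. \<phi> (Y ^ r) = \<phi> (Z ^ r))"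
    for Y Z
    using moments_quadratic_cong[of Y Z] inverse
      moments_quadratic_cong[of "quadratic 0 1 s Y" "quadratic 0 1 s Z" 0 1 "- s"] by metis
  then show ?thesis
    unfolding shifted_square_sum_eq assms[symmetric] s_def[symmetric] identically_distributed_iff .
qed

lemma cumulant_nonconstant_part:
  assumes "boolean_independent scale \<phi> {1..n} Xs"
    and "\<And>i. i \<in> {1..n} \<Longrightarrow> identically_distributed \<phi> (Xs i) X" and "r \<ge> 1"
  shows "boolean_cumulant_of \<phi> r (nonconstant_part n Xs a) =
    (\<Sum>i=1..n. boolean_cumulant_of \<phi> r (quadratic 1 (of_real (2 * a i)) 0 X))"
proof -
  have "boolean_cumulant_of \<phi> r (nonconstant_part n Xs a) =
      (\<Sum>i=1..n. boolean_cumulant_of \<phi> r (quadratic 1 (of_real (2 * a i)) 0 (Xs i)))"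
    unfolding nonconstant_part_def
    by (rule cumulant_sum[OF assms(1)[unfolded boolean_independent_def]])
       (use subalgebra_generated quadratic_in_generated assms(3) in \<open>auto simp: subalgebra_def\<close>)
  also have "\<dots> = (\<Sum>i=1..n. boolean_cumulant_of \<phi> r (quadratic 1 (of_real (2 * a i)) 0 X))"
    using assms(2,3)
    by (intro sum.cong refl cumulant_quadratic_cong)
       (auto simp: identically_distributed_iff)
  finally show ?thesis .
qed

text \<open>
  Write \<open>f a\<close> for the cumulant on the left.  It grows like \<open>L a\<^sup>r\<close>, where \<open>L\<close> is a nonzero
  multiple of the cumulant of \<open>X\<close>; but \<open>2 f(a) = f(\<surd>2 a) + f(0)\<close> leaves only \<open>a\<^sup>2\<close> as an
  order of growth by a power of \<open>a\<close>, so \<open>L = 0\<close>.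
\<close>

lemma cumulant_vanishes_of_additive_in_square:
  assumes "r > 2"
    and eq: "\<And>a. 2 * boolean_cumulant_of \<phi> r (quadratic 1 (of_real (2 * a)) 0 X) =
      boolean_cumulant_of \<phi> r (quadratic 1 (of_real (2 * (sqrt 2 * a))) 0 X) +
      boolean_cumulant_of \<phi> r (quadratic 1 0 0 X)"
  shows "boolean_cumulant_of \<phi> r X = 0"
proof -
  define f where "f = (\<lambda>a. boolean_cumulant_of \<phi> r (quadratic 1 (of_real (2 * a)) 0 X))"
  define L where "L = 2 ^ r * boolean_cumulant_of \<phi> r X"
  have lim: "((\<lambda>a. f a / of_real (a ^ r)) \<longlongrightarrow> L) at_top"
    unfolding f_def L_def by (rule cumulant_quadratic_tendsto) (use assms(1) in simp)
  have "filterlim (\<lambda>a::real. sqrt 2 * a) at_top at_top"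
    by (rule filterlim_tendsto_pos_mult_at_top[OF tendsto_const _ filterlim_ident]) simp
  from filterlim_compose[OF lim this]
  have lim2: "((\<lambda>a. f (sqrt 2 * a) / of_real ((sqrt 2 * a) ^ r)) \<longlongrightarrow> L) at_top" .
  have "((\<lambda>a. inverse (a ^ r)) \<longlongrightarrow> (0::real)) at_top"
    by (rule tendsto_inverse_0_at_top, rule filterlim_pow_at_top) (use assms(1) in \<open>auto intro: filterlim_ident\<close>)
  from tendsto_of_real[OF this, where 'a = complex]
  have lim0: "((\<lambda>a. inverse (of_real (a ^ r))) \<longlongrightarrow> (0::complex)) at_top"
    by simp
  have "((\<lambda>a. of_real (sqrt 2 ^ r) * (f (sqrt 2 * a) / of_real ((sqrt 2 * a) ^ r)) +
      f 0 * inverse (of_real (a ^ r))) \<longlongrightarrow> of_real (sqrt 2 ^ r) * L + f 0 * 0) at_top"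
    by (intro tendsto_intros lim2 lim0)
  moreover have "of_real (sqrt 2 ^ r) * (f (sqrt 2 * a) / of_real ((sqrt 2 * a) ^ r)) +
      f 0 * inverse (of_real (a ^ r)) = 2 * (f a / of_real (a ^ r))" for a
  proof -
    have "2 * f a = f (sqrt 2 * a) + f 0"
      using eq[of a] by (simp add: f_def)
    then have "2 * (f a / of_real (a ^ r)) = (f (sqrt 2 * a) + f 0) / of_real (a ^ r)"
      by simp
    moreover have "of_real (sqrt 2 ^ r) * (f (sqrt 2 * a) / of_real ((sqrt 2 * a) ^ r)) =
        f (sqrt 2 * a) / of_real (a ^ r)"
      by (simp add: power_mult_distrib)
    ultimately show ?thesis
      by (simp only: add_divide_distrib divide_inverse[symmetric])
  qed
  ultimately have "((\<lambda>a. 2 * (f a / of_real (a ^ r))) \<longlongrightarrow> of_real (sqrt 2 ^ r) * L) at_top"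
    by simp
  moreover have "((\<lambda>a. 2 * (f a / of_real (a ^ r))) \<longlongrightarrow> 2 * L) at_top"
    by (intro tendsto_intros lim)
  ultimately have "of_real (sqrt 2 ^ r) * L = 2 * L"
    using tendsto_unique trivial_limit_at_top_linorder by blast
  moreover have "sqrt 2 ^ 2 < sqrt 2 ^ r"
    using assms(1) by (intro power_strict_increasing) auto
  then have "complex_of_real (sqrt 2 ^ r) \<noteq> of_real 2"
    unfolding of_real_eq_iff by simp
  ultimately show ?thesis
    by (simp add: L_def)
qed

end

theorem theorem4p4:
  fixes scale :: "complex \<Rightarrow> 'a::ring_1 \<Rightarrow> 'a"
    and star :: "'a \<Rightarrow> 'a"
    and \<phi> :: "'a \<Rightarrow> complex"
    and n :: nat
    and X :: 'a
    and Xs :: "nat \<Rightarrow> 'a"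
  assumes "nc_probability_space scale star \<phi>"
    and "n \<ge> 2"
    and "star X = X"
    and "\<And>i. i \<in> {1..n} \<Longrightarrow> star (Xs i) = Xs i"
    and "boolean_independent scale \<phi> {1..n} Xs"
    and "\<And>i. i \<in> {1..n} \<Longrightarrow> identically_distributed \<phi> (Xs i) X"
    and "boolean_cumulant_of \<phi> 1 X = 0"
    and "boolean_cumulant_of \<phi> 2 X = 1"
  shows "(\<forall>a b :: nat \<Rightarrow> real.
            (\<Sum>i=1..n. (a i)\<^sup>2) = (\<Sum>i=1..n. (b i)\<^sup>2) \<longrightarrow>
            identically_distributed \<phi>
              (shifted_square_sum scale n Xs a) (shifted_square_sum scale n Xs b))
         \<longleftrightarrow> boolean_gaussian \<phi> X"
    (is "?invariant \<longleftrightarrow> _")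
proof -
  interpret nc_probability_space scale star \<phi>
    by (rule assms(1))
  define f where "f = (\<lambda>r a. boolean_cumulant_of \<phi> r (quadratic 1 (of_real (2 * a)) 0 X))"
  have cumulant: "boolean_cumulant_of \<phi> r (nonconstant_part n Xs a) = (\<Sum>i=1..n. f r (a i))"
    if "r \<ge> 1" for r a
    unfolding f_def by (rule cumulant_nonconstant_part[OF assms(5,6) that])
  have same_law: "identically_distributed \<phi>
        (shifted_square_sum scale n Xs a) (shifted_square_sum scale n Xs b) \<longleftrightarrow>
      (\<forall>r\<ge>1. (\<Sum>i=1..n. f r (a i)) = (\<Sum>i=1..n. f r (b i)))"
    if "(\<Sum>i=1..n. (a i)\<^sup>2) = (\<Sum>i=1..n. (b i)\<^sup>2)" for a b
    unfolding identically_distributed_shifted_square_sum_iff[OF that]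
    by (auto simp only: identically_distributed_def cumulant)
  have invariant_iff: "?invariant \<longleftrightarrow> (\<forall>a b :: nat \<Rightarrow> real.
      (\<Sum>i=1..n. (a i)\<^sup>2) = (\<Sum>i=1..n. (b i)\<^sup>2) \<longrightarrow>
      (\<forall>r\<ge>1. (\<Sum>i=1..n. f r (a i)) = (\<Sum>i=1..n. f r (b i))))"
    by (simp only: same_law cong: imp_cong)
  show ?thesis
  proof
    assume ?invariant
    then have inv: "(\<Sum>i=1..n. f r (a i)) = (\<Sum>i=1..n. f r (b i))"
      if "r \<ge> 1" "(\<Sum>i=1..n. (a i)\<^sup>2) = (\<Sum>i=1..n. (b i)\<^sup>2)" for r a b
      using that invariant_iff by blast
    have split: "(\<Sum>i=1..n. g i) = g 1 + g 2 + (\<Sum>i=3..n. g i)" for g :: "nat \<Rightarrow> 'b::comm_monoid_add"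
      using assms(2) by (simp add: sum.atLeast_Suc_atMost numeral_2_eq_2 numeral_3_eq_3 add.assoc)
    show "boolean_gaussian \<phi> X"
      unfolding boolean_gaussian_def
    proof (intro allI impI)
      fix r :: nat assume r: "r > 2"
      have "2 * f r t = f r (sqrt 2 * t) + f r 0" for t
      proof -
        \<comment> \<open>Two shift vectors of equal Euclidean length: \<open>(t, t, 0, \<dots>)\<close> and \<open>(\<surd>2 t, 0, \<dots>)\<close>.\<close>
        let ?a = "\<lambda>i::nat. if i \<le> 2 then t else 0" and ?b = "\<lambda>i::nat. if i \<le> 1 then sqrt 2 * t else 0"
        have "(\<Sum>i=1..n. f r (?a i)) = (\<Sum>i=1..n. f r (?b i))"
          using r by (intro inv, simp, unfold split) (simp add: power_mult_distrib)
        moreover have "(\<Sum>i=3..n. f r (?a i)) = (\<Sum>i=3..n. f r (?b i))"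
          by (intro sum.cong) auto
        ultimately show ?thesis
          unfolding split by simp
      qed
      then show "boolean_cumulant_of \<phi> r X = 0"
        by (intro cumulant_vanishes_of_additive_in_square[OF r]) (simp add: f_def)
    qed
  next
    assume G: "boolean_gaussian \<phi> X"
    have f: "f r t = (if r = 1 then 1 else of_real (4 * t\<^sup>2))" if "r \<ge> 1" for r t
      using gaussian_cumulant_quadratic[OF G assms(7,8) that, of "of_real t"] by (simp add: f_def)
    have "(\<Sum>i=1..n. f r (a i)) = (if r = 1 then of_nat n else of_real (4 * (\<Sum>i=1..n. (a i)\<^sup>2)))"
      if "r \<ge> 1" for r a
      using that by (simp add: f sum_distrib_left)
    then show ?invariant
      unfolding invariant_iff by simp
  qed
qed

end
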